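(* Consider the bilinear system on $\mathrm{GL}^+(n)$ $$\dot X(t)=AX(t)+\Big(\sum_{k=1}^m u_k(t)E_{i_kj_k}\Big)X(t),\qquad X(0)=I_n,$$ with $A\in\mathfrak{gl}(n)$ and $E_{i_kj_k}\in\{E_{ij}:1\le i,j\le n\}$ for $k=1,\dots,m$ (the case $i_k=j_k$ being allowed). Suppose each weakly connected component of $\mathcal{G}^{\ast}_{\rm contr}$ is strongly connected and contains at least two nodes. Then the system is accessible on $\mathrm{GL}^+(n)$ if the union digraph $\mathcal{G}^{\ast}_{\rm drift}\cup\mathcal{G}^{\ast}_{\rm contr}:=(\mathrm{V},\mathcal{E}^{\ast}_{\rm drift}\cup\mathcal{E}^{\ast}_{\rm contr})$ is strongly connected and $\mathcal{G}^{\ast}_{\rm contr}$ has at least one self-loop.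
   Context: $\mathrm{GL}^+(n)$ is the connected component containing the identity $I_n$ of the group of real invertible $n\times n$ matrices, and its Lie algebra is $\mathfrak{gl}(n)=\mathbb{R}^{n\times n}$. $E_{ij}\in\mathbb{R}^{n\times n}$ has $(i,j)$-entry $1$ and all other entries $0$. The controls $u_k(t)\in\mathbb{R}$ are piecewise constant signals. For $T\ge 0$, $\mathcal{R}_T(I_n)$ is the set of all terminal points $X(T)$ of solutions of the system with $X(0)=I_n$ (over all admissible controls), and $\mathcal{R}(I_n)=\bigcup_{T\ge 0}\mathcal{R}_T(I_n)$. The system is accessible on $\mathrm{GL}^+(n)$ if $\mathcal{R}(I_n)$ has an interior point in $\mathrm{GL}^+(n)$. Let $\mathrm{V}=\{1,\dots,n\}$. The drift interaction graph is the digraph $\mathcal{G}^{\ast}_{\rm drift}=(\mathrm{V},\mathcal{E}^{\ast}_{\rm drift})$ where, for $i,j\in\mathrm{V}$, $(i,j)\in\mathcal{E}^{\ast}_{\rm drift}$ if and only if $[A]_{ij}\ne 0$. The controlled interaction graph is the digraph $\mathcal{G}^{\ast}_{\rm contr}=(\mathrm{V},\mathcal{E}^{\ast}_{\rm contr})$ with arc set $\mathcal{E}^{\ast}_{\rm contr}=\{(i_1,j_1),\dots,(i_m,j_m)\}$. Both may have self-loops $(i,i)$. A digraph is strongly connected if every two nodes are mutually reachable by directed paths; a node is reachable from itself. A weakly connected component of a digraph is a connected component when arc directions are ignored (a node with no arcs to or from other nodes is a component with one node). *)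

theory Defs
  imports "HOL-Analysis.Analysis" "Graph_Theory.Digraph_Component"
begin

definition GL_plus :: "(real^'n^'n) set" where
  "GL_plus = connected_component_set {X. invertible X} (mat 1)"

definition matrix_unit :: "'n \<Rightarrow> 'n \<Rightarrow> real^'n^'n" where
  "matrix_unit i j = (\<chi> a b. if a = i \<and> b = j then 1 else 0)"

text \<open>Values at the finitely many switching times are unconstrained.\<close>

definition piecewise_constant_on :: "(real \<Rightarrow> real) \<Rightarrow> real \<Rightarrow> real \<Rightarrow> bool" where
  "piecewise_constant_on f a b \<longleftrightarrow>
     (\<exists>S. finite S \<and> (\<forall>c d. a \<le> c \<and> c < d \<and> d \<le> b \<and> {c<..<d} \<inter> S = {} \<longrightarrow>
        f constant_on {c<..<d}))"

text \<open>
  A solution on \<open>[0, T]\<close> of \<open>X' = A X + (\<Sum>k. u\<^sub>k B\<^sub>k) X\<close> on \<open>GL\<^sup>+(n)\<close>. As the controls may jump,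
  a solution is a continuous curve satisfying the differential equation at all but finitely
  many times.
\<close>

definition bilinear_solution ::
    "real^'n^'n \<Rightarrow> nat \<Rightarrow> (nat \<Rightarrow> real^'n^'n) \<Rightarrow> (nat \<Rightarrow> real \<Rightarrow> real) \<Rightarrow> real
      \<Rightarrow> (real \<Rightarrow> real^'n^'n) \<Rightarrow> bool" where
  "bilinear_solution A m B u T X \<longleftrightarrow>
     continuous_on {0..T} X \<and> X ` {0..T} \<subseteq> GL_plus \<and>
     (\<exists>S. finite S \<and> (\<forall>t\<in>{0..T} - S.
        (X has_vector_derivative A ** X t + (\<Sum>k=1..m. u k t *\<^sub>R B k) ** X t)
          (at t within {0..T})))"

definition reachable_at ::
    "real^'n^'n \<Rightarrow> nat \<Rightarrow> (nat \<Rightarrow> real^'n^'n) \<Rightarrow> real \<Rightarrow> (real^'n^'n) set" where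
  "reachable_at A m B T =
     {X T | X u. (\<forall>k\<in>{1..m}. piecewise_constant_on (u k) 0 T) \<and>
        X 0 = mat 1 \<and> bilinear_solution A m B u T X}"

definition reachable_set ::
    "real^'n^'n \<Rightarrow> nat \<Rightarrow> (nat \<Rightarrow> real^'n^'n) \<Rightarrow> (real^'n^'n) set" where
  "reachable_set A m B = (\<Union>T\<in>{0..}. reachable_at A m B T)"

definition accessible ::
    "real^'n^'n \<Rightarrow> nat \<Rightarrow> (nat \<Rightarrow> real^'n^'n) \<Rightarrow> bool" where
  "accessible A m B \<longleftrightarrow> (top_of_set GL_plus) interior_of (reachable_set A m B) \<noteq> {}"

definition drift_graph :: "real^'n^'n \<Rightarrow> ('n, 'n \<times> 'n) pre_digraph" where
  "drift_graph A = with_proj \<lparr> pverts = UNIV, parcs = {(i, j). A $ i $ j \<noteq> 0} \<rparr>"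

definition contr_graph :: "nat \<Rightarrow> (nat \<Rightarrow> 'n) \<Rightarrow> (nat \<Rightarrow> 'n) \<Rightarrow> ('n, 'n \<times> 'n) pre_digraph" where
  "contr_graph m i j = with_proj \<lparr> pverts = UNIV, parcs = (\<lambda>k. (i k, j k)) ` {1..m} \<rparr>"

text \<open>
  \<^const>\<open>Digraph_Component.connected\<close> ignores arc directions, so the weakly connected
  components are the maximal subgraphs with this property.
\<close>

definition weakly_connected_component ::
    "('a, 'b) pre_digraph \<Rightarrow> ('a, 'b) pre_digraph \<Rightarrow> bool" where
  "weakly_connected_component G H \<longleftrightarrow> pre_digraph.max_subgraph G Digraph_Component.connected H"

end

theory Submission
  imports Defs
begin

text \<open>
  The claim follows from a sufficient criterion of Lie theory and a computation with matrix units.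

  The criterion is the Lie algebra rank condition (\<open>accessible_if_generating\<close>): if \<open>A\<close> and the control
  matrices generate all of \<open>gl(n)\<close> as a Lie algebra, the reachable set has interior. Piecewise
  constant controls reach every product \<open>exp(t\<^sub>k X\<^sub>k) \<dots> exp(t\<^sub>1 X\<^sub>1)\<close> with positive durations, where the
  \<open>X\<^sub>i\<close> are the system matrices for constant controls. Consider the span of the directions in which
  such a product moves when its durations vary, pulled back to the identity. Appending factors can
  only enlarge this span, so take a product for which its dimension is maximal. No continuation
  enlarges it, which forces a certain subspace to be invariant under bracketing with all \<open>X\<^sub>i\<close>, and by
  the generation hypothesis the span is everything (\<open>flow_product_spanning\<close>). The product, as a function
  of its durations, is then a submersion, and an open mapping theorem produces an interior point
  (\<open>flow_product_interior\<close>). Choosing a maximal product replaces the usual appeal to integral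
  manifolds.

  For the generation (\<open>lie_subalgebra_eq_UNIV\<close>), fix a node \<open>v\<close> with a self-loop. Starting
  from \<open>E\<^sub>v\<^sub>v\<close>, one follows paths in the union digraph: control arcs move \<open>E\<^sub>v\<^sub>x\<close> to \<open>E\<^sub>v\<^sub>y\<close> directly, while for a drift arc \<open>(x, y)\<close> a bracket with
  \<open>E\<^sub>y\<^sub>z\<close>, where \<open>(y, z)\<close> is a control arc and \<open>z \<noteq> y\<close>, extracts the entry \<open>A\<^sub>x\<^sub>y\<close>
  together with one entry in the column of \<open>v\<close>, which brackets with \<open>E\<^sub>v\<^sub>v\<close> remove. Such an arc exists, and
  \<open>z\<close> leads back to \<open>y\<close>, because every component of the control graph is strongly connected with at
  least two nodes. By strong connectivity of the union every \<open>E\<^sub>v\<^sub>x\<close> is obtained, by transposition every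
  \<open>E\<^sub>x\<^sub>v\<close>, and these generate \<open>gl(n)\<close>.
\<close>

section \<open>The matrix exponential\<close>

lemma bounded_bilinear_matrix_mult:
  "bounded_bilinear ((**) :: real^'n^'m \<Rightarrow> real^'p^'n \<Rightarrow> real^'p^'m)"
proof -
  have "bilinear ((**) :: real^'n^'m \<Rightarrow> real^'p^'n \<Rightarrow> real^'p^'m)"
    unfolding bilinear_def
    by (auto intro!: linearI simp: matrix_add_ldistrib vec_eq_iff matrix_matrix_mult_def
        sum.distrib sum_distrib_left algebra_simps)
  then show ?thesis
    using bilinear_conv_bounded_bilinear by blast
qed

text \<open>
  Supplies the distributive laws, and the product rules for limits and derivatives.
\<close>

interpretation matrix_mult: bounded_bilinear "(**) :: real^'n^'m \<Rightarrow> real^'p^'n \<Rightarrow> real^'p^'m"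
  by (rule bounded_bilinear_matrix_mult)

text \<open>
  In the Euclidean norm of \<^typ>\<open>real^'n^'n\<close> the unit matrix has norm \<open>sqrt n\<close> instead of 1, so
  the exponential of unital normed algebras does not apply.
  Each entry of \<open>exp (t M)\<close> is instead an everywhere convergent real power series in \<open>t\<close>, and the
  termwise differentiation of such series gives the differential equation.
\<close>

primrec matrix_pow :: "real^'n^'n \<Rightarrow> nat \<Rightarrow> real^'n^'n" where
  "matrix_pow M 0 = mat 1"
| "matrix_pow M (Suc k) = M ** matrix_pow M k"

lemma matrix_pow_commute: "matrix_pow M k ** M = M ** matrix_pow M k"
  by (induction k) (simp_all add: matrix_mul_assoc [symmetric])

lemma norm_matrix_pow_le:
  fixes M :: "real^'n^'n"
  obtains C where "C \<ge> 0" "\<And>k. norm (matrix_pow M k) \<le> norm (mat 1 :: real^'n^'n) * C ^ k"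
proof -
  obtain K where K: "K \<ge> 0" "\<And>(X :: real^'n^'n) (Y :: real^'n^'n). norm (X ** Y) \<le> norm X * norm Y * K"
    using matrix_mult.nonneg_bounded by blast
  have "norm (matrix_pow M k) \<le> norm (mat 1 :: real^'n^'n) * (norm M * K) ^ k" for k
  proof (induction k)
    case (Suc k)
    have "norm (matrix_pow M (Suc k)) \<le> norm M * norm (matrix_pow M k) * K"
      using K(2) by simp
    also have "\<dots> \<le> norm M * (norm (mat 1 :: real^'n^'n) * (norm M * K) ^ k) * K"
      using K(1) Suc by (intro mult_right_mono mult_left_mono) auto
    finally show ?case by (simp add: algebra_simps)
  qed simp
  then show ?thesis
    using K(1) that by (meson mult_nonneg_nonneg norm_ge_zero)
qed

definition matrix_exp :: "real^'n^'n \<Rightarrow> real \<Rightarrow> real^'n^'n" where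
  "matrix_exp M t = (\<chi> a b. \<Sum>k. matrix_pow M k $ a $ b / fact k * t ^ k)"

lemma summable_matrix_exp:
  "summable (\<lambda>k. matrix_pow M k $ a $ b / fact k * t ^ k)" for M :: "real^'n^'n"
proof -
  obtain C where C: "C \<ge> 0" "\<And>k. norm (matrix_pow M k) \<le> norm (mat 1 :: real^'n^'n) * C ^ k"
    using norm_matrix_pow_le by blast
  have "summable (\<lambda>k. norm (mat 1 :: real^'n^'n) * ((C * \<bar>t\<bar>) ^ k /\<^sub>R fact k))"
    by (intro summable_mult summable_exp_generic)
  then show ?thesis
  proof (rule summable_comparison_test [rotated], intro exI allI impI)
    fix k
    have "\<bar>matrix_pow M k $ a $ b\<bar> \<le> norm (mat 1 :: real^'n^'n) * C ^ k"
      using component_le_norm_cart [of "matrix_pow M k $ a" b]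
        Finite_Cartesian_Product.norm_nth_le [of "matrix_pow M k" a] C(2)[of k] by linarith
    then have "\<bar>matrix_pow M k $ a $ b\<bar> * (\<bar>t\<bar> ^ k / fact k)
        \<le> norm (mat 1 :: real^'n^'n) * C ^ k * (\<bar>t\<bar> ^ k / fact k)"
      by (intro mult_right_mono) auto
    then show "norm (matrix_pow M k $ a $ b / fact k * t ^ k)
        \<le> norm (mat 1 :: real^'n^'n) * ((C * \<bar>t\<bar>) ^ k /\<^sub>R fact k)"
      by (simp add: abs_mult power_abs power_mult_distrib field_simps)
  qed
qed

lemma matrix_exp_0 [simp]: "matrix_exp M 0 = mat 1"
proof -
  have "(\<Sum>k. matrix_pow M k $ a $ b / fact k * 0 ^ k) = mat 1 $ a $ b" for a b
    using powser_zero [of "\<lambda>k. matrix_pow M k $ a $ b / fact k"] by simp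
  then show ?thesis by (simp add: matrix_exp_def vec_eq_iff)
qed

lemma matrix_exp_commute: "matrix_exp M t ** M = M ** matrix_exp M t"
proof -
  have "(matrix_exp M t ** M) $ a $ b = (M ** matrix_exp M t) $ a $ b" for a b
  proof -
    have "(matrix_exp M t ** M) $ a $ b
        = (\<Sum>l\<in>UNIV. \<Sum>k. matrix_pow M k $ a $ l / fact k * t ^ k * M $ l $ b)"
      unfolding matrix_matrix_mult_def matrix_exp_def
      by (simp only: vec_lambda_beta suminf_mult2 [OF summable_matrix_exp])
    also have "\<dots> = (\<Sum>k. \<Sum>l\<in>UNIV. matrix_pow M k $ a $ l / fact k * t ^ k * M $ l $ b)"
      by (rule suminf_sum [symmetric]) (intro summable_mult2 summable_matrix_exp)
    also have "\<dots> = (\<Sum>k. (matrix_pow M k ** M) $ a $ b / fact k * t ^ k)"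
      unfolding matrix_matrix_mult_def
      by (simp add: sum_distrib_left sum_distrib_right sum_divide_distrib mult_ac)
    also have "\<dots> = (\<Sum>k. \<Sum>l\<in>UNIV. M $ a $ l * (matrix_pow M k $ l $ b / fact k * t ^ k))"
      by (simp only: matrix_pow_commute) (simp add: matrix_matrix_mult_def sum_distrib_left sum_distrib_right
          sum_divide_distrib mult_ac)
    also have "\<dots> = (\<Sum>l\<in>UNIV. \<Sum>k. M $ a $ l * (matrix_pow M k $ l $ b / fact k * t ^ k))"
      by (rule suminf_sum) (intro summable_mult summable_matrix_exp)
    also have "\<dots> = (M ** matrix_exp M t) $ a $ b"
      unfolding matrix_matrix_mult_def matrix_exp_def
      by (simp only: vec_lambda_beta suminf_mult [OF summable_matrix_exp])
    finally show ?thesis .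
  qed
  then show ?thesis by (simp add: vec_eq_iff)
qed

lemma has_vector_derivative_matrix_exp:
  "(matrix_exp M has_vector_derivative M ** matrix_exp M t) (at t)"
proof -
  have *: "((\<lambda>t. matrix_exp M t $ a $ b) has_vector_derivative (M ** matrix_exp M t) $ a $ b) (at t)"
    for a b
  proof -
    have "(\<Sum>k. diffs (\<lambda>k. matrix_pow M k $ a $ b / fact k) k * t ^ k)
        = (\<Sum>k. \<Sum>l\<in>UNIV. M $ a $ l * (matrix_pow M k $ l $ b / fact k * t ^ k))"
      unfolding diffs_def
      by (simp add: matrix_matrix_mult_def sum_distrib_left sum_distrib_right
          sum_divide_distrib mult_ac field_simps del: of_nat_Suc)
    also have "\<dots> = (\<Sum>l\<in>UNIV. \<Sum>k. M $ a $ l * (matrix_pow M k $ l $ b / fact k * t ^ k))"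
      by (rule suminf_sum) (intro summable_mult summable_matrix_exp)
    also have "\<dots> = (M ** matrix_exp M t) $ a $ b"
      unfolding matrix_matrix_mult_def matrix_exp_def
      by (simp only: vec_lambda_beta suminf_mult [OF summable_matrix_exp])
    finally show ?thesis
      using termdiffs_strong_converges_everywhere [OF summable_matrix_exp [of M a b], of t]
      by (simp add: matrix_exp_def has_real_derivative_iff_has_vector_derivative)
  qed
  show ?thesis
    using *
    unfolding has_vector_derivative_def
    by (subst has_derivative_componentwise_within)
       (auto simp: Basis_vec_def inner_axis)
qed

lemma has_vector_derivative_matrix_exp_minus:
  "((\<lambda>t. matrix_exp M (- t)) has_vector_derivative - (M ** matrix_exp M (- t))) (at t)"
  using vector_diff_chain_at [OF has_vector_derivative_minus [OF has_vector_derivative_id]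
      has_vector_derivative_matrix_exp [where M = M]] by (simp add: o_def)

lemma continuous_on_matrix_exp: "continuous_on S (matrix_exp M)"
  by (rule continuous_on_vector_derivative)
    (rule has_vector_derivative_at_within [OF has_vector_derivative_matrix_exp])

text \<open>
  The product has derivative \<open>M exp(tM) exp(-tM) - exp(tM) M exp(-tM)\<close>, which vanishes because
  \<open>M\<close> commutes with its exponential; hence it keeps its value at \<open>t = 0\<close>.
\<close>

lemma matrix_exp_inverse: "matrix_exp M t ** matrix_exp M (- t) = mat 1"
proof -
  have "((\<lambda>t. matrix_exp M t ** matrix_exp M (- t)) has_vector_derivative 0) (at t within UNIV)" for t
  proof -
    from matrix_mult.has_vector_derivative
      [OF has_vector_derivative_matrix_exp has_vector_derivative_matrix_exp_minus]
    have "((\<lambda>t. matrix_exp M t ** matrix_exp M (- t)) has_vector_derivative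
       matrix_exp M t ** - (M ** matrix_exp M (- t)) + M ** matrix_exp M t ** matrix_exp M (- t)) (at t)" .
    then show ?thesis
      by (simp add: matrix_mult.minus_right matrix_mul_assoc matrix_exp_commute [of M t])
  qed
  then obtain c where "\<And>t. matrix_exp M t ** matrix_exp M (- t) = c"
    using has_vector_derivative_zero_constant
      [OF convex_UNIV, of "\<lambda>t. matrix_exp M t ** matrix_exp M (- t)"] by auto
  from this [of t] this [of 0] show ?thesis by simp
qed

lemma matrix_exp_inverse': "matrix_exp M (- t) ** matrix_exp M t = mat 1"
  using matrix_exp_inverse [of M "- t"] by simp

section \<open>Lie subalgebras containing matrix units\<close>

definition commutator :: "real^'n^'n \<Rightarrow> real^'n^'n \<Rightarrow> real^'n^'n" where
  "commutator X Y = X ** Y - Y ** X"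

definition lie_subalgebra :: "(real^'n^'n) set \<Rightarrow> bool" where
  "lie_subalgebra L \<longleftrightarrow> subspace L \<and> (\<forall>X\<in>L. \<forall>Y\<in>L. commutator X Y \<in> L)"

lemma commutator_transpose:
  "commutator (transpose X) (transpose Y) = transpose (commutator Y X)"
  by (simp add: commutator_def matrix_transpose_mul [symmetric]) (simp add: transpose_def vec_eq_iff)

lemma lie_subalgebra_transpose:
  "lie_subalgebra L \<Longrightarrow> lie_subalgebra (transpose -` L)" for L :: "(real^'n^'n) set"
proof -
  assume L: "lie_subalgebra L"
  have "linear (transpose :: real^'n^'n \<Rightarrow> real^'n^'n)"
    by (intro linearI) (simp_all add: transpose_def vec_eq_iff)
  then have "subspace (transpose -` L)"
    using L by (intro linear_subspace_vimage) (simp_all add: lie_subalgebra_def)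
  then show ?thesis
    using L by (simp add: lie_subalgebra_def commutator_transpose [symmetric])
qed

lemma matrix_unit_mult:
  "matrix_unit a b ** matrix_unit c d = (if b = c then matrix_unit a d else 0)"
proof -
  have "(\<Sum>k\<in>UNIV. (if p = a \<and> k = b then 1 else 0) * (if k = c \<and> q = d then 1 else 0 :: real))
     = (\<Sum>k\<in>UNIV. if k = b then (if p = a \<and> q = d \<and> b = c then 1 else 0) else 0)" for p q
    by (intro sum.cong) auto
  then show ?thesis
    by (auto simp: matrix_unit_def matrix_matrix_mult_def vec_eq_iff)
qed

lemma matrix_unit_sandwich:
  "matrix_unit a b ** M ** matrix_unit c d = M $ b $ c *\<^sub>R matrix_unit a d"
proof -
  have 1: "(matrix_unit a b ** M) $ p $ q = (if p = a then M $ b $ q else 0)" for p q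
  proof -
    have "(\<Sum>k\<in>UNIV. (if p = a \<and> k = b then 1 else 0) * M $ k $ q)
      = (\<Sum>k\<in>UNIV. if k = b then (if p = a then M $ b $ q else 0) else 0)"
      by (intro sum.cong) auto
    then show ?thesis by (simp add: matrix_unit_def matrix_matrix_mult_def)
  qed
  have "(\<Sum>k\<in>UNIV. (if p = a then M $ b $ k else 0) * (if k = c \<and> q = d then 1 else 0))
      = (\<Sum>k\<in>UNIV. if k = c then (if p = a \<and> q = d then M $ b $ c else 0) else 0)" for p q
    by (intro sum.cong) auto
  then show ?thesis
    unfolding vec_eq_iff
    by (subst matrix_matrix_mult_def) (auto simp: 1, auto simp: matrix_unit_def)
qed

lemma transpose_matrix_unit: "transpose (matrix_unit a b) = matrix_unit b a"
  by (auto simp: transpose_def matrix_unit_def vec_eq_iff)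

lemma matrix_unit_expansion: "M = (\<Sum>a\<in>UNIV. \<Sum>b\<in>UNIV. M $ a $ b *\<^sub>R matrix_unit a b)"
proof -
  have "(\<Sum>a\<in>UNIV. \<Sum>b\<in>UNIV. M $ a $ b * (if p = a \<and> q = b then 1 else 0)) = M $ p $ q" for p q
  proof -
    have "(\<Sum>b\<in>UNIV. M $ a $ b * (if p = a \<and> q = b then 1 else 0))
        = (\<Sum>b\<in>UNIV. if b = q then (if a = p then M $ a $ q else 0) else 0)" for a
      by (intro sum.cong) auto
    then show ?thesis by simp
  qed
  then show ?thesis by (simp add: vec_eq_iff matrix_unit_def)
qed

text \<open>
  Let \<open>v\<close> carry a self-loop, and follow a path from \<open>v\<close>. If \<open>E\<^sub>v\<^sub>x\<close> lies in the Lie algebra, a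
  control arc \<open>(x, y)\<close> gives \<open>E\<^sub>v\<^sub>y = [E\<^sub>v\<^sub>x, E\<^sub>x\<^sub>y]\<close>. For a drift arc \<open>(x, y)\<close>, take a control arc
  \<open>(y, z)\<close> with \<open>z \<noteq> y\<close>: bracketing \<open>A\<close> with \<open>E\<^sub>v\<^sub>x\<close> and \<open>E\<^sub>y\<^sub>z\<close> isolates the single entry \<open>A\<^sub>x\<^sub>y\<close>, up to
  one further term, which \<open>E\<^sub>v\<^sub>v\<close> removes. This yields \<open>E\<^sub>v\<^sub>z\<close>, and a control path leads from \<open>z\<close>
  back to \<open>y\<close>.
\<close>

lemma matrix_unit_row_closed:
  fixes A :: "real^'n^'n" and R :: "('n \<times> 'n) set"
  assumes L: "lie_subalgebra L"
    and A: "A \<in> L"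
    and units: "\<And>x y. (x, y) \<in> R \<Longrightarrow> matrix_unit x y \<in> L"
    and loop: "(v, v) \<in> R"
    and symm: "\<And>x y. (x, y) \<in> R \<Longrightarrow> (y, x) \<in> R\<^sup>*"
    and exit: "\<And>x. \<exists>y. y \<noteq> x \<and> (x, y) \<in> R"
    and path: "(v, x) \<in> (R \<union> {(x, y). A $ x $ y \<noteq> 0})\<^sup>*"
  shows "matrix_unit v x \<in> L"
proof -
  have sub: "subspace L" and br: "\<And>X Y. X \<in> L \<Longrightarrow> Y \<in> L \<Longrightarrow> commutator X Y \<in> L"
    using L by (auto simp: lie_subalgebra_def)
  have arc: "matrix_unit v y \<in> L" if x: "matrix_unit v x \<in> L" and xy: "(x, y) \<in> R" for x y
  proof (cases "y = v \<or> x = v")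
    case True
    then show ?thesis using units loop xy by blast
  next
    case False
    then have "commutator (matrix_unit v x) (matrix_unit x y) = matrix_unit v y"
      by (simp add: commutator_def matrix_unit_mult)
    then show ?thesis using br x units xy by metis
  qed
  have arcs: "matrix_unit v y \<in> L" if "(x, y) \<in> R\<^sup>*" "matrix_unit v x \<in> L" for x y
    using that by (induction rule: rtrancl_induct) (simp_all add: arc)
  have drift: "matrix_unit v y \<in> L" if x: "matrix_unit v x \<in> L" and xy: "A $ x $ y \<noteq> 0" for x y
  proof -
    obtain z where z: "z \<noteq> y" "(y, z) \<in> R" using exit by blast
    have zy: "(z, y) \<in> R\<^sup>*" using symm z by blast
    consider "y = v" | "z = v" | "x = y" | "y \<noteq> v" "z \<noteq> v" "x \<noteq> y" by blast
    then show ?thesis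
    proof cases
      case 4
      define Y where "Y = commutator (commutator (matrix_unit v x) A) (matrix_unit y z)"
      have Y: "Y \<in> L" unfolding Y_def using br x A units z by blast
      have "Y = matrix_unit v x ** A ** matrix_unit y z - A ** (matrix_unit v x ** matrix_unit y z)
          - (matrix_unit y z ** matrix_unit v x) ** A + matrix_unit y z ** A ** matrix_unit v x"
        by (simp add: Y_def commutator_def matrix_mult.diff_left matrix_mult.diff_right
            matrix_mul_assoc)
      then have Yeq: "Y = A $ x $ y *\<^sub>R matrix_unit v z + A $ z $ v *\<^sub>R matrix_unit y x"
        using 4 by (simp add: matrix_unit_mult matrix_unit_sandwich)
      \<comment> \<open>The unwanted term is \<open>E\<^sub>y\<^sub>x\<close>. The bracket with \<open>E\<^sub>v\<^sub>v\<close> fixes \<open>E\<^sub>v\<^sub>z\<close>; it negates \<open>E\<^sub>y\<^sub>x\<close> if \<open>x = v\<close>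
        and annihilates it otherwise. Adding the first and second iterated brackets cancels it in
        both cases.\<close>
      define E where "E = matrix_unit v v"
      have E: "E \<in> L" using units loop by (simp add: E_def)
      have "commutator E Y = A $ x $ y *\<^sub>R matrix_unit v z
           - (if x = v then A $ z $ v *\<^sub>R matrix_unit y x else 0)"
        using 4 by (simp add: Yeq E_def commutator_def matrix_mult.add_left matrix_mult.add_right
            matrix_mult.scaleR_left matrix_mult.scaleR_right matrix_unit_mult)
      moreover from this have "commutator E (commutator E Y) = A $ x $ y *\<^sub>R matrix_unit v z
           + (if x = v then A $ z $ v *\<^sub>R matrix_unit y x else 0)"
        using 4 by (simp add: E_def commutator_def matrix_mult.diff_left matrix_mult.diff_right
            matrix_mult.scaleR_left matrix_mult.scaleR_right matrix_unit_mult)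
      ultimately have "commutator E (commutator E Y) + commutator E Y
          = (2 * A $ x $ y) *\<^sub>R matrix_unit v z"
        by (simp add: scaleR_2 flip: scaleR_scaleR)
      then have "(2 * A $ x $ y) *\<^sub>R matrix_unit v z \<in> L"
        using br E Y subspace_add [OF sub] by metis
      from subspace_scale [OF sub this, of "1 / (2 * A $ x $ y)"]
      have "matrix_unit v z \<in> L" using xy by simp
      then show ?thesis using arcs zy by blast
    next
      case 1
      then show ?thesis using units loop by simp
    next
      case 2
      then show ?thesis using arcs [OF zy] units loop by simp
    next
      case 3
      then show ?thesis using x by simp
    qed
  qed
  show ?thesis
    using path
  proof (induction rule: rtrancl_induct)
    case base
    show ?case using units loop by simp
  next
    case (step y z)
    then show ?case using arc drift by blast
  qed
qed

text \<open>
  Converts "some arc leaves every node" into "some arc enters every node" when every arc can be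
  travelled back along a path.
\<close>

lemma rtrancl_last_arc: "(x, y) \<in> R\<^sup>* \<Longrightarrow> x \<noteq> y \<Longrightarrow> \<exists>z. z \<noteq> y \<and> (z, y) \<in> R"
proof (induction rule: rtrancl_induct)
  case (step y z)
  then show ?case by (cases "y = z") auto
qed simp

text \<open>
  Transposition maps Lie subalgebras to Lie subalgebras and reverses both graphs, so the lemma on
  the row of \<open>v\<close> also gives its column. The bracket of \<open>E\<^sub>x\<^sub>v\<close> with \<open>E\<^sub>v\<^sub>y\<close> is
  \<open>E\<^sub>x\<^sub>y\<close> for \<open>x \<noteq> y\<close>, and \<open>E\<^sub>x\<^sub>x - E\<^sub>v\<^sub>v\<close> for \<open>x = y\<close>.
\<close>

theorem lie_subalgebra_eq_UNIV:
  fixes A :: "real^'n^'n" and R :: "('n \<times> 'n) set"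
  assumes L: "lie_subalgebra L"
    and A: "A \<in> L"
    and units: "\<And>x y. (x, y) \<in> R \<Longrightarrow> matrix_unit x y \<in> L"
    and loop: "(v, v) \<in> R"
    and symm: "\<And>x y. (x, y) \<in> R \<Longrightarrow> (y, x) \<in> R\<^sup>*"
    and exit: "\<And>x. \<exists>y. y \<noteq> x \<and> (x, y) \<in> R"
    and path: "\<And>x y. (x, y) \<in> (R \<union> {(x, y). A $ x $ y \<noteq> 0})\<^sup>*"
  shows "L = UNIV"
proof -
  have sub: "subspace L" and br: "\<And>X Y. X \<in> L \<Longrightarrow> Y \<in> L \<Longrightarrow> commutator X Y \<in> L"
    using L by (auto simp: lie_subalgebra_def)
  have row: "matrix_unit v x \<in> L" for x
    using matrix_unit_row_closed [OF L A units loop symm exit path] .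
  have col: "matrix_unit x v \<in> L" for x
  proof -
    have "matrix_unit v x \<in> transpose -` L"
    proof (rule matrix_unit_row_closed [where A = "transpose A" and R = "R\<inverse>"])
      show "\<exists>y. y \<noteq> x \<and> (x, y) \<in> R\<inverse>" for x
      proof -
        obtain y where "y \<noteq> x" "(x, y) \<in> R" using exit by blast
        then show ?thesis using rtrancl_last_arc [OF symm] by (metis converseI)
      qed
      have "R\<inverse> \<union> {(x, y). transpose A $ x $ y \<noteq> 0} = (R \<union> {(x, y). A $ x $ y \<noteq> 0})\<inverse>"
        by (auto simp: transpose_def)
      then show "(v, x) \<in> (R\<inverse> \<union> {(x, y). transpose A $ x $ y \<noteq> 0})\<^sup>*"
        using path by (simp add: rtrancl_converse)
      show "(y, x) \<in> (R\<inverse>)\<^sup>*" if "(x, y) \<in> R\<inverse>" for x y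
        using that symm by (simp add: rtrancl_converse)
    qed (use L A units loop in \<open>simp_all add: lie_subalgebra_transpose transpose_matrix_unit\<close>)
    then show ?thesis by (simp add: transpose_matrix_unit)
  qed
  have "matrix_unit x y \<in> L" for x y
  proof (cases "x = y")
    case False
    then have "commutator (matrix_unit x v) (matrix_unit v y) = matrix_unit x y"
      by (simp add: commutator_def matrix_unit_mult)
    then show ?thesis using br row col by metis
  next
    case True
    have "commutator (matrix_unit x v) (matrix_unit v x) + matrix_unit v v = matrix_unit x x"
      by (simp add: commutator_def matrix_unit_mult)
    then show ?thesis using br row col subspace_add [OF sub] True by metis
  qed
  then have "M \<in> L" for M
    by (subst matrix_unit_expansion) (intro subspace_sum subspace_scale sub)
  then show ?thesis by blast
qed

section \<open>Components of the control graph\<close>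

text \<open>
  Among the subgraphs above \<open>K\<close> with property \<open>P\<close>, one with the largest total number of vertices
  and arcs is maximal.
\<close>

lemma (in fin_digraph) ex_max_subgraph:
  assumes "subgraph K G" "P K"
  obtains H where "max_subgraph P H" "subgraph K H"
proof -
  define \<S> where "\<S> = {H. subgraph H G \<and> P H \<and> subgraph K H}"
  define size where "size = (\<lambda>H :: ('a, 'b) pre_digraph. card (verts H) + card (arcs H))"
  have K: "K \<in> \<S>"
    unfolding \<S>_def using assms wf_digraph.subgraph_refl [of K] by (blast elim: subgraphE)
  have bound: "size H \<le> size G" if "H \<in> \<S>" for H
  proof -
    have "verts H \<subseteq> verts G" "arcs H \<subseteq> arcs G" using that by (simp_all add: \<S>_def subgraph_def)
    then show ?thesis unfolding size_def
      by (intro add_mono card_mono finite_verts finite_arcs)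
  qed
  then obtain H where H: "H \<in> \<S>" and max: "\<And>H'. H' \<in> \<S> \<Longrightarrow> size H' \<le> size H"
  proof -
    have "\<exists>H. H \<in> \<S> \<and> (\<forall>H'. H' \<in> \<S> \<longrightarrow> size H' \<le> size H)"
      by (rule ex_has_greatest_nat [where P = "\<lambda>H. H \<in> \<S>" and b = "Suc (size G)", OF K])
        (intro allI impI le_imp_less_Suc bound)
    then show ?thesis using that by (elim exE conjE) simp
  qed
  have "max_subgraph P H"
  proof (rule max_subgraphI)
    fix H' assume H': "H \<noteq> H'" "subgraph H H'" "subgraph H' G"
    show "\<not> P H'"
    proof
      assume "P H'"
      with H'(3) have *: "subgraph H' G \<and> P H'" ..
      have "subgraph K H'" using H H'(2) subgraph_trans [of K H H'] by (simp add: \<S>_def)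
      with * have "H' \<in> \<S>" by (simp add: \<S>_def)
      have sub: "verts H \<subseteq> verts H'" "arcs H \<subseteq> arcs H'" "compatible H' H"
        using H'(2) by (simp_all add: subgraph_def)
      have fin: "finite (verts H')" "finite (arcs H')"
        using * finite_subset [OF _ finite_verts] finite_subset [OF _ finite_arcs]
        by (simp_all add: subgraph_def)
      have "card (verts H) \<le> card (verts H')" "card (arcs H) \<le> card (arcs H')"
        using sub fin by (simp_all add: card_mono)
      with max [OF \<open>H' \<in> \<S>\<close>] have "card (verts H) = card (verts H')" "card (arcs H) = card (arcs H')"
        by (simp_all add: size_def)
      then have "verts H = verts H'" "arcs H = arcs H'"
        using sub fin by (simp_all add: card_subset_eq)
      then show False
        using H'(1) sub(3) by (simp add: compatible_def)
    qed
  qed (use H in \<open>simp_all add: \<S>_def\<close>)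
  moreover have "subgraph K H" using H by (simp add: \<S>_def)
  ultimately show ?thesis by (rule that)
qed

lemma fin_digraph_contr_graph: "fin_digraph (contr_graph m i j :: ('n::finite, 'n \<times> 'n) pre_digraph)"
  by unfold_locales (auto simp: contr_graph_def)

lemma reachable_imp_rtrancl: "u \<rightarrow>\<^sup>*\<^bsub>G\<^esub> v \<Longrightarrow> (u, v) \<in> (arcs_ends G)\<^sup>*"
  unfolding reachable_def by (induction rule: rtrancl_on_induct) (simp_all add: rtrancl.rtrancl_into_rtrancl)

text \<open>
  A control arc, viewed as a subgraph, is connected and so lies in some weakly connected component;
  strong connectivity of that component returns from its head to its tail. In the same way each
  node lies in a component, which contains a second node and a path to it.
\<close>

lemma contr_graph_structure:
  fixes i j :: "nat \<Rightarrow> 'n::finite" and m :: nat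
  defines "R \<equiv> arcs (contr_graph m i j)"
  assumes comp: "\<And>H. weakly_connected_component (contr_graph m i j) H \<Longrightarrow>
             strongly_connected H \<and> card (verts H) \<ge> 2"
  shows contr_graph_symmetric_reachability: "\<And>x y. (x, y) \<in> R \<Longrightarrow> (y, x) \<in> R\<^sup>*"
    and contr_graph_exit: "\<And>x. \<exists>y. y \<noteq> x \<and> (x, y) \<in> R"
proof -
  let ?G = "contr_graph m i j"
  interpret fin_digraph ?G by (rule fin_digraph_contr_graph)
  have ends: "arcs_ends ?G = R" by (simp add: R_def contr_graph_def)
  have reach: "(x, y) \<in> R\<^sup>*"
    if "subgraph H ?G" "strongly_connected H" "x \<in> verts H" "y \<in> verts H" for H x y
  proof -
    have "(x, y) \<in> (arcs_ends H)\<^sup>*"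
      using that by (auto simp: strongly_connected_def intro: reachable_imp_rtrancl)
    then show ?thesis
      using arcs_ends_mono [OF that(1)] rtrancl_mono unfolding ends by blast
  qed
  {
    fix x y :: 'n assume xy: "(x, y) \<in> R"
    define K where "K = with_proj \<lparr>pverts = {x, y}, parcs = {(x, y)}\<rparr>"
    have "wf_digraph K" by unfold_locales (auto simp: K_def)
    then have "subgraph K ?G"
      using xy wf_digraph_axioms by (auto simp: K_def R_def contr_graph_def subgraph_def compatible_def)
    moreover have "Digraph_Component.connected K"
    proof -
      have parcs: "parcs (mk_symmetric K) = {(x, y), (y, x)}"
        by (simp add: K_def parcs_mk_symmetric)
      have verts: "pverts (mk_symmetric K) = {x, y}"
        by (simp add: K_def)
      have stay: "(u, u) \<in> rtrancl_on {x, y} {(x, y), (y, x)}" if "u \<in> {x, y}" for u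
        using that by (rule rtrancl_on_refl)
      have "(x, y) \<in> rtrancl_on {x, y} {(x, y), (y, x)}" "(y, x) \<in> rtrancl_on {x, y} {(x, y), (y, x)}"
        using rtrancl_on_into_rtrancl_on [OF stay] by blast+
      then have "(u, w) \<in> rtrancl_on {x, y} {(x, y), (y, x)}" if "u \<in> {x, y}" "w \<in> {x, y}" for u w
        using that stay by blast
      then show ?thesis
        unfolding connected_def by (intro strongly_connectedI)
            (simp_all only: reachable_def with_proj_simps parcs verts, simp)
    qed
    ultimately obtain H where H: "max_subgraph Digraph_Component.connected H" "subgraph K H"
      by (rule ex_max_subgraph)
    then have "strongly_connected H" using comp by (simp add: weakly_connected_component_def)
    moreover have "x \<in> verts H" "y \<in> verts H" using H(2) by (auto simp: K_def subgraph_def)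
    ultimately show "(y, x) \<in> R\<^sup>*" using reach H(1) by (auto simp: max_subgraph_def)
  next
    fix x :: 'n
    define K where "K = with_proj \<lparr>pverts = {x}, parcs = {}\<rparr>"
    have "wf_digraph K" by unfold_locales (auto simp: K_def)
    then have "subgraph K ?G"
      using wf_digraph_axioms by (auto simp: K_def contr_graph_def subgraph_def compatible_def)
    moreover have "Digraph_Component.connected K"
    proof -
      have verts: "pverts (mk_symmetric K) = {x}"
        by (simp add: K_def)
      show ?thesis
        unfolding connected_def
        by (intro strongly_connectedI)
          (simp_all only: with_proj_simps verts reachable_def, simp_all add: rtrancl_on_refl)
    qed
    ultimately obtain H where H: "max_subgraph Digraph_Component.connected H" "subgraph K H"
      by (rule ex_max_subgraph)
    then have sc: "strongly_connected H" and card: "card (verts H) \<ge> 2"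
      using comp by (auto simp: weakly_connected_component_def)
    have x: "x \<in> verts H" using H(2) by (auto simp: K_def subgraph_def)
    obtain y where y: "y \<in> verts H" "y \<noteq> x"
    proof -
      have "verts H \<noteq> {x}" using card by auto
      then show ?thesis using x that by blast
    qed
    have "(x, y) \<in> R\<^sup>*" using reach H(1) sc x y by (auto simp: max_subgraph_def)
    then have "(y, x) \<in> (R\<inverse>)\<^sup>*" by (simp add: rtrancl_converse)
    then show "\<exists>y. y \<noteq> x \<and> (x, y) \<in> R" using rtrancl_last_arc y(2) by fastforce
  }
qed

lemma union_graph_path:
  assumes "strongly_connected (Digraph_Component.union (drift_graph A) (contr_graph m i j))"
  shows "(x, y) \<in> (arcs (contr_graph m i j) \<union> {(x, y). A $ x $ y \<noteq> 0})\<^sup>*"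
proof -
  let ?U = "Digraph_Component.union (drift_graph A) (contr_graph m i j)"
  have "x \<rightarrow>\<^sup>*\<^bsub>?U\<^esub> y"
    using assms by (auto simp: strongly_connected_def Digraph_Component.union_def drift_graph_def)
  moreover have "arcs_ends ?U = arcs (contr_graph m i j) \<union> {(x, y). A $ x $ y \<noteq> 0}"
    by (auto simp: Digraph_Component.union_def drift_graph_def arcs_ends_conv)
  ultimately show ?thesis using reachable_imp_rtrancl by metis
qed

section \<open>Products of flows\<close>

text \<open>
  Besides the product \<open>g\<close> of exponentials \<open>exp (t X)\<close> with \<open>t > 0\<close> and its inverse \<open>h\<close>, the relation
  records the directions in which \<open>g\<close> moves when the durations vary: the derivative of \<open>g\<close> with
  respect to the duration of a factor is \<open>g Z\<close>, with \<open>Z \<in> D\<close> the direction recorded for that factor.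
  As \<open>exp (t X)\<close> commutes with \<open>X\<close>, this direction \<open>h X g\<close> can be computed from the product before
  the factor is added; in this left trivialisation, further factors leave the earlier directions
  unchanged, so \<open>D\<close> only grows.
\<close>

inductive flow_product :: "(real^'n^'n) set \<Rightarrow> real^'n^'n \<Rightarrow> real^'n^'n \<Rightarrow> (real^'n^'n) set \<Rightarrow> bool"
  for F where
  flow_product_id: "flow_product F (mat 1) (mat 1) {}"
| flow_product_step: "flow_product F g h D \<Longrightarrow> X \<in> F \<Longrightarrow> 0 < t \<Longrightarrow>
     flow_product F (matrix_exp X t ** g) (h ** matrix_exp X (- t)) (insert (h ** X ** g) D)"

lemma flow_product_inverse: "flow_product F g h D \<Longrightarrow> g ** h = mat 1 \<and> h ** g = mat 1"
proof (induction rule: flow_product.induct)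
  case (flow_product_step g h D X t)
  have "(matrix_exp X t ** g) ** (h ** matrix_exp X (- t))
      = matrix_exp X t ** (g ** h) ** matrix_exp X (- t)"
    "(h ** matrix_exp X (- t)) ** (matrix_exp X t ** g)
      = h ** (matrix_exp X (- t) ** matrix_exp X t) ** g"
    by (simp_all add: matrix_mul_assoc)
  then show ?case
    using flow_product_step.IH by (simp add: matrix_exp_inverse matrix_exp_inverse')
qed simp

text \<open>
  The bracket \<open>[Z, Y]\<close> is the right derivative of \<open>exp(-tY) Z exp(tY)\<close> at \<open>t = 0\<close>, and subspaces
  are closed. Positive times suffice, which matters because the system cannot be run backwards.
\<close>

lemma commutator_in_invariant_subspace:
  fixes M :: "(real^'n^'n) set"
  assumes M: "subspace M"
    and inv: "\<And>Z t. Z \<in> M \<Longrightarrow> 0 < t \<Longrightarrow> matrix_exp Y (- t) ** Z ** matrix_exp Y t \<in> M"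
    and Z: "Z \<in> M"
  shows "commutator Y Z \<in> M"
proof -
  define f where "f = (\<lambda>t. matrix_exp Y (- t) ** Z ** matrix_exp Y t)"
  have "((\<lambda>t. matrix_exp Y (- t)) has_vector_derivative - Y) (at 0)"
    using has_vector_derivative_matrix_exp_minus [of Y 0] by simp
  from matrix_mult.has_vector_derivative [OF matrix_mult.has_vector_derivative
      [OF this has_vector_derivative_const [of Z]] has_vector_derivative_matrix_exp [of Y]]
  have "(f has_vector_derivative Z ** Y - Y ** Z) (at 0)"
    by (simp add: f_def matrix_mult.minus_left)
  then have "((\<lambda>t. (f t - f 0 - t *\<^sub>R (Z ** Y - Y ** Z)) /\<^sub>R norm t) \<longlongrightarrow> 0) (at 0)"
    by (simp add: has_vector_derivative_def has_derivative_at_within [where s = UNIV])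
  then have "((\<lambda>t. (f t - f 0 - t *\<^sub>R (Z ** Y - Y ** Z)) /\<^sub>R norm t) \<longlongrightarrow> 0) (at_right 0)"
    using tendsto_within_subset by blast
  moreover have "\<forall>\<^sub>F t in at_right 0. (f t - f 0 - t *\<^sub>R (Z ** Y - Y ** Z)) /\<^sub>R norm t
      = (f t - f 0) /\<^sub>R t - (Z ** Y - Y ** Z)"
    using eventually_at_right_less
    by eventually_elim (simp add: scaleR_diff_right)
  ultimately have "((\<lambda>t. (f t - f 0) /\<^sub>R t - (Z ** Y - Y ** Z)) \<longlongrightarrow> 0) (at_right 0)"
    by (rule Lim_transform_eventually)
  then have "((\<lambda>t. (f t - f 0) /\<^sub>R t) \<longlongrightarrow> Z ** Y - Y ** Z) (at_right 0)"
    by (rule LIM_zero_cancel)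
  moreover have "eventually (\<lambda>t. (f t - f 0) /\<^sub>R t \<in> M) (at_right 0)"
    using eventually_at_right_less
  proof eventually_elim
    case (elim t)
    then show ?case
      using inv [OF Z elim] Z by (auto simp: f_def intro!: subspace_scale subspace_diff M)
  qed
  ultimately have "Z ** Y - Y ** Z \<in> M"
    by (intro Lim_in_closed_set [OF closed_subspace [OF M] _ trivial_limit_at_right_real])
  then show ?thesis
    using subspace_neg [OF M, of "Z ** Y - Y ** Z"] by (simp add: commutator_def)
qed

text \<open>
  The elements of \<open>M\<close> whose bracket maps \<open>M\<close> into itself form a Lie subalgebra, by the Jacobi
  identity.
\<close>

lemma ad_invariant_subspace_eq_UNIV:
  fixes M F :: "(real^'n^'n) set"
  assumes gen: "\<And>L. lie_subalgebra L \<Longrightarrow> F \<subseteq> L \<Longrightarrow> L = UNIV"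
    and M: "subspace M" and F: "F \<subseteq> M"
    and inv: "\<And>Y Z. Y \<in> F \<Longrightarrow> Z \<in> M \<Longrightarrow> commutator Y Z \<in> M"
  shows "M = UNIV"
proof -
  define N where "N = {Y \<in> M. \<forall>Z\<in>M. commutator Y Z \<in> M}"
  have "lie_subalgebra N"
    unfolding lie_subalgebra_def
  proof (intro conjI ballI)
    have "commutator (c *\<^sub>R X) Z = c *\<^sub>R commutator X Z"
      "commutator (X + Y) Z = commutator X Z + commutator Y Z" for c and X Y Z :: "real^'n^'n"
      by (simp_all add: commutator_def matrix_mult.scaleR_left matrix_mult.scaleR_right
          matrix_mult.add_left matrix_mult.add_right scaleR_diff_right)
    moreover have "commutator 0 Z = 0" for Z :: "real^'n^'n"
      by (simp add: commutator_def matrix_mult.zero_left matrix_mult.zero_right)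
    ultimately show "subspace N"
      unfolding N_def by (subst subspace_def)
        (auto intro: subspace_0 [OF M] subspace_add [OF M] subspace_scale [OF M])
  next
    fix X Y assume XY: "X \<in> N" "Y \<in> N"
    have jacobi: "commutator (commutator X Y) Z = commutator X (commutator Y Z) - commutator Y (commutator X Z)"
      for Z
      by (simp add: commutator_def matrix_mult.diff_left matrix_mult.diff_right matrix_mul_assoc)
    show "commutator X Y \<in> N"
      using XY unfolding N_def jacobi by (auto intro: subspace_diff [OF M] simp: jacobi)
  qed
  moreover have "F \<subseteq> N" using F inv by (auto simp: N_def)
  ultimately have "N = UNIV" by (rule gen)
  then show ?thesis by (auto simp: N_def)
qed

text \<open>
  Choose a product \<open>g\<close> whose directions span a space of maximal dimension. Then every
  product that records at least the directions of \<open>g\<close>, such as a continuation of \<open>g\<close> by further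
  factors, records only directions in that same span. The matrices \<open>Z\<close> for which \<open>h' Z g'\<close> stays
  in the span, for all such products \<open>g'\<close> with inverse \<open>h'\<close>, form a subspace that contains
  \<open>F\<close> and is invariant under conjugation by the flows, hence under bracketing
  with \<open>F\<close>. So all matrices belong to it, and the case \<open>g' = g\<close> shows that the span is
  everything.
\<close>

lemma flow_product_spanning:
  fixes F :: "(real^'n^'n) set"
  assumes gen: "\<And>L. lie_subalgebra L \<Longrightarrow> F \<subseteq> L \<Longrightarrow> L = UNIV"
  obtains g h D where "flow_product F g h D" "span D = UNIV"
proof -
  define P where "P = (\<lambda>n. \<exists>g h D. flow_product F g h D \<and> dim D = n)"
  have "P 0" unfolding P_def using flow_product_id [of F] dim_empty by blast
  moreover have "\<And>n. P n \<Longrightarrow> n \<le> DIM(real^'n^'n)"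
    unfolding P_def using dim_subset_UNIV by blast
  ultimately obtain N where "P N" and max: "\<And>n. P n \<Longrightarrow> n \<le> N"
    using Nat.ex_has_greatest_nat [of P 0 "DIM(real^'n^'n)"] by blast
  then obtain g h D where orb: "flow_product F g h D" and N: "dim D = N"
    unfolding P_def by blast
  have stable: "D' \<subseteq> span D" if "flow_product F g' h' D'" "D \<subseteq> D'" for g' h' D'
  proof -
    have "dim D' \<le> dim D" using max that(1) N by (auto simp: P_def)
    then have "span D = span D'"
      using dim_eq_span [OF that(2)] by simp
    then show ?thesis using span_superset by blast
  qed
  define M where "M = {Z. \<forall>g' h' D'. flow_product F g' h' D' \<longrightarrow> D \<subseteq> D' \<longrightarrow> h' ** Z ** g' \<in> span D}"
  have M: "subspace M"
    unfolding M_def by (subst subspace_def)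
      (auto simp: matrix_mult.zero_left matrix_mult.zero_right matrix_mult.add_left
        matrix_mult.add_right matrix_mult.scaleR_left matrix_mult.scaleR_right
        intro: span_zero span_add span_scale)
  have "M = UNIV"
  proof (rule ad_invariant_subspace_eq_UNIV [OF gen M])
    show "F \<subseteq> M"
    proof
      fix X assume X: "X \<in> F"
      have "h' ** X ** g' \<in> span D" if "flow_product F g' h' D'" "D \<subseteq> D'" for g' h' D'
        using stable [OF flow_product_step [OF that(1) X zero_less_one]] that(2) by auto
      then show "X \<in> M" by (auto simp: M_def)
    qed
    fix Y Z assume Y: "Y \<in> F" and Z: "Z \<in> M"
    show "commutator Y Z \<in> M"
    proof (rule commutator_in_invariant_subspace [OF M _ Z])
      fix Z and t :: real assume Z: "Z \<in> M" and t: "0 < t"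
      have "h' ** (matrix_exp Y (- t) ** Z ** matrix_exp Y t) ** g' \<in> span D"
        if "flow_product F g' h' D'" "D \<subseteq> D'" for g' h' D'
      proof -
        have "(h' ** matrix_exp Y (- t)) ** Z ** (matrix_exp Y t ** g') \<in> span D"
          using Z flow_product_step [OF that(1) Y t] that(2) unfolding M_def by blast
        then show ?thesis by (simp add: matrix_mul_assoc)
      qed
      then show "matrix_exp Y (- t) ** Z ** matrix_exp Y t \<in> M" by (auto simp: M_def)
    qed
  qed
  have "Z \<in> span D" for Z
  proof -
    have "h ** (g ** Z ** h) ** g \<in> span D"
      using \<open>M = UNIV\<close> orb by (auto simp: M_def)
    moreover have "h ** (g ** Z ** h) ** g = (h ** g) ** Z ** (h ** g)"
      by (simp add: matrix_mul_assoc)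
    ultimately show ?thesis using flow_product_inverse [OF orb] by simp
  qed
  then show ?thesis using that orb by blast
qed

text \<open>
  Every linear choice \<open>s \<mapsto> \<Sum>\<^sub>b (s \<bullet> b) f b\<close> of an infinitesimal motion in the span of the recorded
  directions is realised by letting the durations depend linearly on \<open>s\<close>. Parametrising by a matrix
  \<open>s\<close> rather than by the tuple of durations keeps the parameter space the same for products of any
  length. Durations stay positive near \<open>s = 0\<close>.
\<close>

lemma flow_product_variation:
  fixes F :: "(real^'n^'n) set" and f :: "real^'n^'n \<Rightarrow> real^'n^'n"
  assumes "flow_product F g h D" and "\<And>b. b \<in> Basis \<Longrightarrow> f b \<in> span D"
  shows "\<exists>G. G 0 = g \<and> continuous_on UNIV G \<and>
    (G has_derivative (\<lambda>s. g ** (\<Sum>b\<in>Basis. (s \<bullet> b) *\<^sub>R f b))) (at 0) \<and>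
    (\<forall>\<^sub>F s in nhds 0. \<exists>h D. flow_product F (G s) h D)"
  using assms
proof (induction arbitrary: f rule: flow_product.induct)
  case flow_product_id
  then have "g ** (\<Sum>b\<in>Basis. (s \<bullet> b) *\<^sub>R f b) = 0" for s and g :: "real^'n^'n"
    by (simp add: matrix_mult.zero_right)
  then show ?case
    using flow_product.flow_product_id [of F] by (intro exI [of _ "\<lambda>_. mat 1"]) auto
next
  case (flow_product_step g h D X t)
  have "\<forall>b\<in>Basis. \<exists>k. f b - k *\<^sub>R (h ** X ** g) \<in> span D"
    using flow_product_step.prems by (simp add: span_insert)
  then obtain k where k: "\<And>b. b \<in> Basis \<Longrightarrow> f b - k b *\<^sub>R (h ** X ** g) \<in> span D"
    by metis
  then obtain G where G: "G 0 = g" "continuous_on UNIV G"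
    "(G has_derivative (\<lambda>s. g ** (\<Sum>b\<in>Basis. (s \<bullet> b) *\<^sub>R (f b - k b *\<^sub>R (h ** X ** g))))) (at 0)"
    "\<forall>\<^sub>F s in nhds 0. \<exists>h D. flow_product F (G s) h D"
    using flow_product_step.IH [of "\<lambda>b. f b - k b *\<^sub>R (h ** X ** g)"] by auto
  \<comment> \<open>The duration of the new factor absorbs the coefficients of the new direction \<open>h X g\<close>;
    the earlier factors realise the remainder.\<close>
  define a :: "real^'n^'n \<Rightarrow> real" where "a = (\<lambda>s. \<Sum>b\<in>Basis. (s \<bullet> b) * k b)"
  define E where "E = matrix_exp X t"
  have gh: "g ** h = mat 1" using flow_product_inverse flow_product_step.hyps(1) by blast
  have "((\<lambda>s. t + a s) has_derivative a) (at 0)"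
    unfolding a_def by (auto intro!: derivative_eq_intros)
  moreover have "(matrix_exp X has_derivative (\<lambda>r. r *\<^sub>R (X ** E))) (at (t + a 0))"
    using has_vector_derivative_matrix_exp [of X t] by (simp add: has_vector_derivative_def a_def E_def)
  ultimately have "((\<lambda>s. matrix_exp X (t + a s)) has_derivative (\<lambda>s. a s *\<^sub>R (X ** E))) (at 0)"
    by (rule has_derivative_compose)
  from matrix_mult.FDERIV [OF this G(3)]
  have "((\<lambda>s. matrix_exp X (t + a s) ** G s) has_derivative
     (\<lambda>s. E ** (g ** (\<Sum>b\<in>Basis. (s \<bullet> b) *\<^sub>R (f b - k b *\<^sub>R (h ** X ** g)))) + (a s *\<^sub>R (X ** E)) ** g)) (at 0)"
    by (simp add: G(1) E_def a_def)
  moreover have "E ** (g ** (\<Sum>b\<in>Basis. (s \<bullet> b) *\<^sub>R (f b - k b *\<^sub>R (h ** X ** g)))) + (a s *\<^sub>R (X ** E)) ** g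
     = E ** g ** (\<Sum>b\<in>Basis. (s \<bullet> b) *\<^sub>R f b)" for s
  proof -
    have "(\<Sum>b\<in>Basis. (s \<bullet> b) *\<^sub>R (f b - k b *\<^sub>R (h ** X ** g)))
        = (\<Sum>b\<in>Basis. (s \<bullet> b) *\<^sub>R f b) - a s *\<^sub>R (h ** X ** g)"
      by (simp add: a_def scaleR_diff_right sum_subtractf scaleR_sum_left)
    moreover have "E ** (g ** (h ** X ** g)) = X ** E ** g"
    proof -
      have "E ** (g ** (h ** X ** g)) = E ** (g ** h) ** X ** g" by (simp add: matrix_mul_assoc)
      then show ?thesis by (simp add: gh E_def matrix_exp_commute)
    qed
    ultimately show ?thesis
      by (simp add: matrix_mult.diff_right matrix_mult.scaleR_right matrix_mult.scaleR_left
          matrix_mul_assoc)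
  qed
  ultimately have der: "((\<lambda>s. matrix_exp X (t + a s) ** G s) has_derivative
     (\<lambda>s. E ** g ** (\<Sum>b\<in>Basis. (s \<bullet> b) *\<^sub>R f b))) (at 0)"
    by simp
  have cont_a: "continuous_on UNIV (\<lambda>s. t + a s)"
    unfolding a_def by (intro continuous_intros)
  have cont: "continuous_on UNIV (\<lambda>s. matrix_exp X (t + a s) ** G s)"
    by (intro matrix_mult.continuous_on G(2)
        continuous_on_compose2 [OF continuous_on_matrix_exp [of UNIV] cont_a]) auto
  have "\<forall>\<^sub>F s in nhds 0. 0 < t + a s"
  proof -
    have "open {s. 0 < t + a s}"
      using open_Collect_less [OF continuous_on_const cont_a] by simp
    then show ?thesis
      using flow_product_step.hyps(3) by (auto simp: eventually_nhds a_def intro!: exI [of _ "{s. 0 < t + a s}"])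
  qed
  then have "\<forall>\<^sub>F s in nhds 0. \<exists>h D. flow_product F (matrix_exp X (t + a s) ** G s) h D"
    using G(4) by eventually_elim (use flow_product.flow_product_step flow_product_step.hyps(2) in blast)
  with der cont G(1) show ?case
    by (intro exI [of _ "\<lambda>s. matrix_exp X (t + a s) ** G s"]) (auto simp: E_def a_def)
qed

text \<open>
  With all matrices as directions, the variation has the invertible derivative \<open>s \<mapsto> g s\<close> at \<open>0\<close>, so
  it maps neighbourhoods of \<open>0\<close> to neighbourhoods of \<open>g\<close>.
\<close>

theorem flow_product_interior:
  fixes F :: "(real^'n^'n) set"
  assumes gen: "\<And>L. lie_subalgebra L \<Longrightarrow> F \<subseteq> L \<Longrightarrow> L = UNIV"
  shows "interior {g. \<exists>h D. flow_product F g h D} \<noteq> {}"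
proof -
  obtain g h D where orb: "flow_product F g h D" and D: "span D = UNIV"
    using flow_product_spanning [OF gen] .
  obtain G where G: "continuous_on UNIV G"
    "(G has_derivative (\<lambda>s. g ** (\<Sum>b\<in>Basis. (s \<bullet> b) *\<^sub>R b))) (at 0)"
    "\<forall>\<^sub>F s in nhds 0. \<exists>h D. flow_product F (G s) h D"
    using flow_product_variation [OF orb, of "\<lambda>b. b"] D by auto
  obtain T where T: "open T" "0 \<in> T" "\<And>s. s \<in> T \<Longrightarrow> \<exists>h D. flow_product F (G s) h D"
    using G(3) by (auto simp: eventually_nhds)
  have "G 0 \<in> interior (G ` T)"
  proof (rule sussmann_open_mapping [OF open_UNIV G(1)])
    show "(G has_derivative (\<lambda>s. g ** s)) (at 0)"
      using G(2) by (simp add: euclidean_representation)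
    show "(\<lambda>s. g ** s) \<circ> (\<lambda>s. h ** s) = id"
      using flow_product_inverse [OF orb] by (auto simp: matrix_mul_assoc)
    show "bounded_linear (\<lambda>s. h ** s)" by (rule matrix_mult.bounded_linear_right)
  qed (use T in \<open>auto simp: interior_open\<close>)
  moreover have "G ` T \<subseteq> {g. \<exists>h D. flow_product F g h D}" using T(3) by blast
  ultimately show ?thesis using interior_mono by blast
qed

section \<open>Reachability and the rank condition\<close>

text \<open>
  The curve \<open>s \<mapsto> exp(sX) P\<close> joins \<open>P\<close> to \<open>exp(tX) P\<close> through invertible matrices.
\<close>

lemma GL_plus_matrix_exp:
  assumes "P \<in> GL_plus"
  shows "matrix_exp X t ** P \<in> GL_plus"
proof -
  let ?C = "(\<lambda>s. matrix_exp X s ** P) ` UNIV"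
  have P: "connected_component {X. invertible X} (mat 1) P"
    using assms by (simp add: GL_plus_def)
  then have "invertible P" using connected_component_in by blast
  moreover have "invertible (matrix_exp X s)" for s
    unfolding invertible_def using matrix_exp_inverse matrix_exp_inverse' by blast
  ultimately have "?C \<subseteq> {X. invertible X}" by (auto intro: invertible_mult)
  moreover have "Topological_Spaces.connected ?C"
    by (intro connected_continuous_image connected_UNIV matrix_mult.continuous_on
        continuous_on_matrix_exp continuous_on_const)
  moreover have "P \<in> ?C" by (rule image_eqI [of _ _ 0]) simp_all
  moreover have "matrix_exp X t ** P \<in> ?C" by blast
  ultimately have "connected_component {X. invertible X} P (matrix_exp X t ** P)"
    unfolding connected_component_def by blast
  then show ?thesis
    using connected_component_trans [OF P] by (simp add: GL_plus_def)
qed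

lemma mat_1_in_GL_plus: "mat 1 \<in> GL_plus"
proof -
  have "invertible (mat 1 :: real^'n^'n)"
    unfolding invertible_def by (rule exI [of _ "mat 1"]) simp
  then show ?thesis by (simp add: GL_plus_def)
qed

lemma piecewise_constant_on_append:
  assumes "piecewise_constant_on f a b"
  shows "piecewise_constant_on (\<lambda>s. if s \<le> b then f s else k) a c"
proof -
  obtain S where S: "finite S" "\<And>p q. a \<le> p \<Longrightarrow> p < q \<Longrightarrow> q \<le> b \<Longrightarrow> {p<..<q} \<inter> S = {} \<Longrightarrow>
      f constant_on {p<..<q}"
    using assms unfolding piecewise_constant_on_def by blast
  have "(\<lambda>s. if s \<le> b then f s else k) constant_on {p<..<q}"
    if "a \<le> p" "p < q" "{p<..<q} \<inter> insert b S = {}" for p q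
  proof (cases "q \<le> b")
    case True
    then have "f constant_on {p<..<q}" using S(2) that by blast
    then obtain y where "\<And>s. s \<in> {p<..<q} \<Longrightarrow> f s = y" unfolding constant_on_def by blast
    then show ?thesis
      unfolding constant_on_def using True by (intro exI [of _ y]) auto
  next
    case False
    then have "b \<le> p" using that(3) by force
    then show ?thesis unfolding constant_on_def by (intro exI [of _ k]) auto
  qed
  then show ?thesis
    unfolding piecewise_constant_on_def using S(1) by (intro exI [of _ "insert b S"]) auto
qed

text \<open>
  Constant controls \<open>c\<close> during the extra time \<open>t\<close> continue a trajectory ending in \<open>g\<close> by
  \<open>exp((s - T) Y) g\<close>. The junction time \<open>T\<close> joins the finite set of exceptional times.
\<close>

lemma reachable_at_append:
  fixes A :: "real^'n^'n" and B :: "nat \<Rightarrow> real^'n^'n"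
  assumes g: "g \<in> reachable_at A m B T" and T: "0 \<le> T" and t: "0 < t"
  defines "Y \<equiv> \<lambda>c. A + (\<Sum>k=1..m. c k *\<^sub>R B k)"
  shows "matrix_exp (Y c) t ** g \<in> reachable_at A m B (T + t)"
proof -
  obtain X u where g_eq: "g = X T" and u: "\<And>k. k \<in> {1..m} \<Longrightarrow> piecewise_constant_on (u k) 0 T"
    and X0: "X 0 = mat 1" and sol: "bilinear_solution A m B u T X"
    using g unfolding reachable_at_def by blast
  obtain S where cont: "continuous_on {0..T} X" and GL: "X ` {0..T} \<subseteq> GL_plus" and S: "finite S"
    and der: "\<And>s. s \<in> {0..T} - S \<Longrightarrow>
      (X has_vector_derivative A ** X s + (\<Sum>k=1..m. u k s *\<^sub>R B k) ** X s) (at s within {0..T})"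
    using sol unfolding bilinear_solution_def by blast
  define E where "E = (\<lambda>s. matrix_exp (Y c) (s - T) ** g)"
  define X' where "X' = (\<lambda>s. if s \<le> T then X s else E s)"
  define u' where "u' = (\<lambda>k s. if s \<le> T then u k s else c k)"
  have E_T: "E T = X T" by (simp add: E_def g_eq)
  have E_der: "(E has_vector_derivative Y c ** E s) (at s)" for s
  proof -
    have "((\<lambda>s. matrix_exp (Y c) (s - T)) has_vector_derivative Y c ** matrix_exp (Y c) (s - T)) (at s)"
      using vector_diff_chain_at [OF has_vector_derivative_diff
          [OF has_vector_derivative_id has_vector_derivative_const]
          has_vector_derivative_matrix_exp [where M = "Y c"]]
      by (simp add: o_def)
    from matrix_mult.has_vector_derivative [OF this has_vector_derivative_const [of g]]
    show ?thesis by (simp add: E_def matrix_mult.zero_right matrix_mul_assoc)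
  qed
  have "continuous_on {T..T + t} E"
    by (rule continuous_on_vector_derivative) (rule has_vector_derivative_at_within [OF E_der])
  then have "continuous_on ({0..T} \<union> {T..T + t}) X'"
    unfolding X'_def using cont E_T by (intro continuous_on_cases) auto
  moreover have "{0..T} \<union> {T..T + t} = {0..T + t}" using T t by auto
  ultimately have cont': "continuous_on {0..T + t} X'" by simp
  have "g \<in> GL_plus" using GL T by (auto simp: g_eq)
  then have GL': "X' ` {0..T + t} \<subseteq> GL_plus"
    using GL by (auto simp: X'_def E_def GL_plus_matrix_exp)
  have der': "(X' has_vector_derivative A ** X' s + (\<Sum>k=1..m. u' k s *\<^sub>R B k) ** X' s)
      (at s within {0..T + t})" if s: "s \<in> {0..T + t} - insert T S" for s
  proof (cases "s < T")
    case True
    have "(X has_vector_derivative A ** X s + (\<Sum>k=1..m. u k s *\<^sub>R B k) ** X s) (at s within {0..T})"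
      using der s True by auto
    moreover have "at s within {0..T} = at s within {0..T + t}"
      using True t by (intro at_within_nhd [of s "{..<T}"]) auto
    ultimately have "(X has_vector_derivative A ** X s + (\<Sum>k=1..m. u k s *\<^sub>R B k) ** X s)
        (at s within {0..T + t})" by simp
    then have "(X' has_vector_derivative A ** X s + (\<Sum>k=1..m. u k s *\<^sub>R B k) ** X s)
        (at s within {0..T + t})"
      by (rule has_vector_derivative_transform_within [of _ _ _ _ "T - s"])
        (use True s in \<open>auto simp: X'_def dist_real_def\<close>)
    then show ?thesis using True by (simp add: X'_def u'_def)
  next
    case False
    then have Ts: "T < s" using s by simp
    have "(E has_vector_derivative Y c ** E s) (at s within {0..T + t})"
      using E_der by (rule has_vector_derivative_at_within)
    then have "(X' has_vector_derivative Y c ** E s) (at s within {0..T + t})"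
      by (rule has_vector_derivative_transform_within [of _ _ _ _ "s - T"])
        (use Ts s in \<open>auto simp: X'_def dist_real_def\<close>)
    then show ?thesis using Ts by (simp add: X'_def u'_def Y_def matrix_mult.add_left)
  qed
  have "bilinear_solution A m B u' (T + t) X'"
    unfolding bilinear_solution_def using cont' GL' der' S by blast
  moreover have "piecewise_constant_on (u' k) 0 (T + t)" if "k \<in> {1..m}" for k
    unfolding u'_def using piecewise_constant_on_append u that by blast
  moreover have "X' 0 = mat 1" using X0 T by (simp add: X'_def)
  moreover have "matrix_exp (Y c) t ** g = X' (T + t)" using t by (simp add: X'_def E_def)
  ultimately show ?thesis unfolding reachable_at_def by blast
qed

lemma flow_product_subset_reachable_set:
  fixes A :: "real^'n^'n" and B :: "nat \<Rightarrow> real^'n^'n"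
  assumes "flow_product (range (\<lambda>c. A + (\<Sum>k=1..m. c k *\<^sub>R B k))) g h D"
  shows "g \<in> reachable_set A m B"
proof -
  have "\<exists>T\<ge>0. g \<in> reachable_at A m B T"
    using assms
  proof (induction rule: flow_product.induct)
    case flow_product_id
    have "bilinear_solution A m B (\<lambda>_ _. 0) 0 (\<lambda>_. mat 1)"
      unfolding bilinear_solution_def
      by (intro conjI exI [of _ "{0}"]) (auto simp: mat_1_in_GL_plus)
    moreover have "piecewise_constant_on (\<lambda>_. 0) 0 0"
      unfolding piecewise_constant_on_def by (intro exI [of _ "{}"]) auto
    ultimately have "mat 1 \<in> reachable_at A m B 0"
      unfolding reachable_at_def by (intro CollectI exI [of _ "\<lambda>_. mat 1"] exI [of _ "\<lambda>_ _. 0"]) simp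
    then show ?case by blast
  next
    case (flow_product_step g h D X t)
    then obtain T c where T: "0 \<le> T" "g \<in> reachable_at A m B T"
      and X: "X = A + (\<Sum>k=1..m. c k *\<^sub>R B k)"
      by blast
    show ?case
      using reachable_at_append [OF T(2,1) flow_product_step.hyps(3)] T(1) flow_product_step.hyps(3) X
      by (intro exI [of _ "T + t"]) simp
  qed
  then show ?thesis unfolding reachable_set_def by auto
qed

lemma reachable_set_subset_GL_plus: "reachable_set A m B \<subseteq> GL_plus"
  unfolding reachable_set_def reachable_at_def bilinear_solution_def by auto

text \<open>
  The Lie algebra rank condition: constant controls make every product of exponentials of the
  matrices \<open>A + \<Sum>\<^sub>k c\<^sub>k B k\<close> reachable, and the span of
  these matrices contains \<open>A\<close> and all \<open>B k\<close>.
\<close>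

theorem accessible_if_generating:
  fixes A :: "real^'n^'n" and B :: "nat \<Rightarrow> real^'n^'n"
  assumes gen: "\<And>L. lie_subalgebra L \<Longrightarrow> A \<in> L \<Longrightarrow> (\<And>k. k \<in> {1..m} \<Longrightarrow> B k \<in> L) \<Longrightarrow> L = UNIV"
  shows "accessible A m B"
proof -
  define F where "F = range (\<lambda>c. A + (\<Sum>k=1..m. c k *\<^sub>R B k))"
  have "L = UNIV" if L: "lie_subalgebra L" "F \<subseteq> L" for L
  proof (rule gen [OF L(1)])
    have F: "A + (\<Sum>k=1..m. c k *\<^sub>R B k) \<in> L" for c using L(2) by (auto simp: F_def)
    \<comment> \<open>Zero controls give \<open>A\<close>, and a single unit control gives \<open>A + B k\<close>.\<close>
    show A: "A \<in> L" using F [of "\<lambda>_. 0"] by simp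
    fix k assume k: "k \<in> {1..m}"
    have "(\<Sum>l=1..m. (if l = k then 1 else 0) *\<^sub>R B l) = (\<Sum>l=1..m. if l = k then B l else 0)"
      by (intro sum.cong) auto
    then have "A + B k \<in> L" using F [of "\<lambda>l. if l = k then 1 else 0"] k by simp
    then have "(A + B k) - A \<in> L"
      using A L(1) by (intro subspace_diff) (simp_all add: lie_subalgebra_def)
    then show "B k \<in> L" by simp
  qed
  then have "interior {g. \<exists>h D. flow_product F g h D} \<noteq> {}" by (rule flow_product_interior)
  moreover have "{g. \<exists>h D. flow_product F g h D} \<subseteq> reachable_set A m B"
    unfolding F_def using flow_product_subset_reachable_set by blast
  ultimately obtain g where g: "g \<in> interior (reachable_set A m B)"
    using interior_mono by blast
  then have "g \<in> (top_of_set GL_plus) interior_of (reachable_set A m B)"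
    unfolding interior_of_def
  proof (intro CollectI exI [of _ "interior (reachable_set A m B)"] conjI)
    show "openin (top_of_set GL_plus) (interior (reachable_set A m B))"
      using order_trans [OF interior_subset reachable_set_subset_GL_plus] open_interior
      by (rule open_subset)
  qed (use g in \<open>simp_all add: interior_subset\<close>)
  then show ?thesis unfolding accessible_def by blast
qed

section \<open>Accessibility from the interaction graphs\<close>

theorem theorem5:
  fixes A :: "real^'n^'n"
    and m :: nat
    and i j :: "nat \<Rightarrow> 'n"
  assumes "\<And>H. weakly_connected_component (contr_graph m i j) H \<Longrightarrow>
             strongly_connected H \<and> card (verts H) \<ge> 2"
    and "strongly_connected (Digraph_Component.union (drift_graph A) (contr_graph m i j))"
    and "\<exists>v. (v, v) \<in> arcs (contr_graph m i j)"
  shows "accessible A m (\<lambda>k. matrix_unit (i k) (j k))"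
proof (rule accessible_if_generating)
  fix L :: "(real^'n^'n) set"
  assume L: "lie_subalgebra L" "A \<in> L" "\<And>k. k \<in> {1..m} \<Longrightarrow> matrix_unit (i k) (j k) \<in> L"
  obtain v where "(v, v) \<in> arcs (contr_graph m i j)" using assms(3) by blast
  moreover have "matrix_unit x y \<in> L" if "(x, y) \<in> arcs (contr_graph m i j)" for x y
    using that L(3) by (auto simp: contr_graph_def)
  ultimately show "L = UNIV"
    using lie_subalgebra_eq_UNIV [OF L(1,2), of "arcs (contr_graph m i j)" v]
      contr_graph_symmetric_reachability [OF assms(1)] contr_graph_exit [OF assms(1)]
      union_graph_path [OF assms(2)]
    by blast
qed

end
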